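(* Assume the following statement (the special case $n=k=1$ of the Uniqueness Conjecture): whenever $b_0,b_1\in\mathbb{Q}$ are such that the congruence $$\binom{p-1}{p-1}\equiv b_0+b_1\,p\,H(\{1\};p-1)\pmod{p^{4}}$$ holds for all sufficiently large primes $p$, one has $b_0=b_{0,1}(1)$ and $b_1=b_{1,1}(1)$. Then there are infinitely many primes $p$ such that the numerator of the Bernoulli number $B_{p-3}$ is not divisible by $p$.
   Context: $H(\{1\};p-1)=\sum_{i=1}^{p-1}\frac1i$. For integers $0\le j\le n$, the extremal polynomial $b_{j,n}(T)\in\mathbb{Q}[T]$ is the unique polynomial of degree at most $2n+1$ satisfying $b_{j,n}(T)\equiv (T-1)^j \pmod{(T-1)^{n+1}}$ and $b_{j,n}(T)\equiv (-1)^jT^j\pmod{T^{n+1}}$; in particular $b_{0,1}(T)=1$ and $b_{1,1}(T)=T^2-T$, so $b_{0,1}(1)=1$ and $b_{1,1}(1)=0$. The Bernoulli numbers are given by $\frac{t}{e^t-1}=\sum_{m\ge0}B_m\frac{t^m}{m!}$. For rational numbers, $x\equiv y\pmod{p^m}$ means $x-y$ has $p$-adic valuation at least $m$. For reference, the Uniqueness Conjecture in general states: if $n\ge 0$ and $k$ are integers and $b_0,\ldots,b_n\in\mathbb{Q}$ are such that $\binom{kp-1}{p-1}\equiv\sum_{j=0}^n b_jp^jH(\{1\}^j;p-1)\pmod{p^{2n+2}}$ for all sufficiently large primes $p$ (where $H(\{1\}^j;m)=\sum_{m\ge i_1>\cdots>i_j\ge1}\frac1{i_1\cdots i_j}$),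 then $b_j=b_{j,n}(k)$ for $j=0,\ldots,n$. *)

theory Defs
  imports
    "HOL-Computational_Algebra.Computational_Algebra"
    "HOL-Computational_Algebra.Field_as_Ring"
    "HOL-Number_Theory.Number_Theory"
begin

definition padic_val :: "nat \<Rightarrow> rat \<Rightarrow> int" where
  "padic_val p x =
     (let (a, b) = quotient_of x
      in int (multiplicity (int p) a) - int (multiplicity (int p) b))"

(* The disjunct x = y accounts for 0 having p-adic valuation infinity, which the
   integer-valued padic_val cannot express. *)
definition rat_cong :: "nat \<Rightarrow> nat \<Rightarrow> rat \<Rightarrow> rat \<Rightarrow> bool" where
  "rat_cong p m x y \<longleftrightarrow> x = y \<or> int m \<le> padic_val p (x - y)"

definition H1 :: "nat \<Rightarrow> rat" where
  "H1 m = (\<Sum>i = 1..m. 1 / of_nat i)"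

(* The quotient of power series is genuine: both sides of the division have subdegree 1
   (see bernoulli_generating_function below). *)
definition bernoulli :: "nat \<Rightarrow> rat" where
  "bernoulli m = fact m * fps_nth (fps_X / (fps_exp 1 - 1)) m"

definition is_extremal_poly :: "nat \<Rightarrow> nat \<Rightarrow> rat poly \<Rightarrow> bool" where
  "is_extremal_poly j n b \<longleftrightarrow>
     degree b \<le> 2 * n + 1 \<and>
     [b = [:-1, 1:] ^ j] (mod [:-1, 1:] ^ (n + 1)) \<and>
     [b = (-1) ^ j * [:0, 1:] ^ j] (mod [:0, 1:] ^ (n + 1))"

(* Well defined by ex1_extremal_poly below, which does not even need j \<le> n. *)
definition extremal_poly :: "nat \<Rightarrow> nat \<Rightarrow> rat poly" where
  "extremal_poly j n = (THE b. is_extremal_poly j n b)"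

lemma bernoulli_generating_function:
  "Abs_fps (\<lambda>m. bernoulli m / fact m) * (fps_exp 1 - 1) = fps_X"
proof -
  let ?E = "fps_exp 1 - 1 :: rat fps"
  have "?E $ 1 = 1" by simp
  then have E: "?E \<noteq> 0" by (metis fps_zero_nth zero_neq_one)
  have sub: "subdegree ?E = 1"
    by (rule subdegreeI) auto
  then have "?E dvd fps_X"
    using E by (simp add: fps_dvd_iff)
  moreover have "Abs_fps (\<lambda>m. bernoulli m / fact m) = fps_X / ?E"
    by (simp add: fps_eq_iff bernoulli_def)
  ultimately show ?thesis by simp
qed

lemma ex1_extremal_poly: "\<exists>!b. is_extremal_poly j n b"
proof -
  let ?P = "[:-1, 1:] ^ (n + 1) :: rat poly" and ?Q = "[:0, 1:] ^ (n + 1) :: rat poly"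
  let ?u = "[:-1, 1:] ^ j :: rat poly" and ?v = "(-1) ^ j * [:0, 1:] ^ j :: rat poly"
  have "coprime [:-1, 1 :: rat:] [:0, 1:]"
  proof (rule coprimeI)
    fix c :: "rat poly"
    assume "c dvd [:-1, 1:]" "c dvd [:0, 1:]"
    then have "c dvd [:0, 1:] - [:-1, 1:]" by (rule dvd_diff[rotated])
    then show "is_unit c" by (simp add: one_pCons)
  qed
  then have cop: "coprime ?P ?Q"
    by (simp only: coprime_power_left_iff coprime_power_right_iff simp_thms)
  have P0: "?P \<noteq> 0" and Q0: "?Q \<noteq> 0" by (rule power_not_zero, simp)+
  have "degree ?P = n + 1" "degree ?Q = n + 1"
    by (subst degree_power_eq, simp_all del: power_Suc)+
  then have deg: "degree (?P * ?Q) = 2 * n + 2"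
    using degree_mult_eq[OF P0 Q0] by simp
  have PQ0: "?P * ?Q \<noteq> 0" using P0 Q0 by (rule no_zero_divisors)
  obtain r s where rs: "r * ?P + s * ?Q = 1"
    using cop by (metis bezout_coefficients_fst_snd coprime_imp_gcd_eq_1)
  let ?w = "?v * r * ?P + ?u * s * ?Q"
  have wu: "[?w = ?u] (mod ?P)"
  proof -
    have "?w - ?u = ?v * r * ?P + ?u * s * ?Q - ?u * (r * ?P + s * ?Q)" using rs by simp
    also have "\<dots> = ?P * (?v * r - ?u * r)" by (simp add: algebra_simps)
    finally show ?thesis by (simp only: cong_iff_dvd_diff dvd_triv_left)
  qed
  have wv: "[?w = ?v] (mod ?Q)"
  proof -
    have "?w - ?v = ?v * r * ?P + ?u * s * ?Q - ?v * (r * ?P + s * ?Q)" using rs by simp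
    also have "\<dots> = ?Q * (?u * s - ?v * s)" by (simp add: algebra_simps)
    finally show ?thesis by (simp only: cong_iff_dvd_diff dvd_triv_left)
  qed
  let ?b = "?w mod (?P * ?Q)"
  have c: "[?b = ?w] (mod ?P * ?Q)" by (simp only: cong_mod_left cong_refl)
  have "degree ?b \<le> 2 * n + 1"
    using degree_mod_less[OF PQ0, of ?w] unfolding deg by auto
  moreover have "[?b = ?u] (mod ?P)"
    using cong_trans[OF cong_modulus_mult[OF c] wu] .
  moreover have "[?b = ?v] (mod ?Q)"
    using cong_trans[OF cong_dvd_modulus[OF c dvd_triv_right] wv] .
  ultimately have ex: "is_extremal_poly j n ?b" unfolding is_extremal_poly_def by blast
  show ?thesis
  proof (rule ex1I[of _ ?b], rule ex)
    fix b assume b: "is_extremal_poly j n b"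
    have "?P dvd b - ?b" "?Q dvd b - ?b"
      using b ex unfolding is_extremal_poly_def
      by (meson cong_iff_dvd_diff cong_sym cong_trans)+
    then have dvd: "?P * ?Q dvd b - ?b" using cop by (rule divides_mult)
    have "degree (b - ?b) \<le> 2 * n + 1"
      using b ex unfolding is_extremal_poly_def by (intro degree_diff_le) auto
    then have "b - ?b = 0"
      using dvd_imp_degree_le[OF dvd] deg by fastforce
    then show "b = ?b" by simp
  qed
qed

end

theory Submission
  imports Defs
begin

text \<open>
  If only finitely many primes \<open>p\<close> had \<open>p \<nmid> B\<^bsub>p-3\<^esub>\<close>, then \<open>p\<^sup>4\<close> would divide
  \<open>p H\<^bsub>p-1\<^esub>\<close> for all large \<open>p\<close>; hence \<open>(b\<^sub>0, b\<^sub>1) = (1, 0)\<close> and \<open>(1, 1)\<close> would both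
  satisfy the congruence, against uniqueness.  To see that \<open>p | B\<^bsub>p-3\<^esub>\<close> forces
  \<open>p\<^sup>3 | H\<^bsub>p-1\<^esub>\<close>, let \<open>S = \<Sum> 1/j\<^sup>2\<close> and \<open>D = \<Sum> H\<^bsub>j-1\<^esub>/j\<^sup>2\<close> over \<open>0 < j < p\<close>.
  Pairing \<open>i\<close> with \<open>p - i\<close> gives \<open>2 H\<^bsub>p-1\<^esub> \<equiv> - p S\<close> modulo \<open>p\<^sup>3\<close>, while expanding
  \<open>H\<^sub>p = \<Sum> (-1)\<^bsup>j-1\<^esup> (p choose j) / j\<close> gives \<open>H\<^bsub>p-1\<^esub> \<equiv> p S - p\<^sup>2 D\<close>; the sum is
  \<open>3 H\<^bsub>p-1\<^esub> \<equiv> - p\<^sup>2 D\<close>.  Finally, Fermat's little theorem and Faulhaber's formula show that \<open>D\<close>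
  is congruent modulo \<open>p\<close> to a \<open>p\<close>-integral combination of power sums, in which only the
  coefficient of \<open>B\<^bsub>p-3\<^esub>\<close> multiplies a power sum that is not divisible by \<open>p\<close>.
\<close>

section \<open>Ideals of the rationals that are integral at \<open>p\<close>\<close>

text \<open>For prime \<open>p\<close> this is the ideal generated by \<open>p ^ k\<close> in the
  integers localized at \<open>p\<close>. The fraction \<open>a / b\<close> need not be reduced and
  \<open>a = 0\<close> is allowed, so closure under sums needs neither normalization nor a separate
  case for zero.\<close>

definition padic_ideal :: "nat \<Rightarrow> nat \<Rightarrow> rat set" where
  "padic_ideal p k = {of_nat p ^ k * of_int a / of_int b | a b. \<not> int p dvd b}"

lemma padic_idealI: "\<not> int p dvd b \<Longrightarrow> of_nat p ^ k * of_int a / of_int b \<in> padic_ideal p k"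
  unfolding padic_ideal_def by blast

lemma padic_idealE:
  assumes "x \<in> padic_ideal p k"
  obtains a b where "x = of_nat p ^ k * of_int a / of_int b" "\<not> int p dvd b" "b \<noteq> 0"
  using assms unfolding padic_ideal_def by fastforce

lemma padic_ideal_mult:
  assumes "prime p" "x \<in> padic_ideal p k" "y \<in> padic_ideal p l"
  shows "x * y \<in> padic_ideal p (k + l)"
proof -
  obtain a b where x: "x = of_nat p ^ k * of_int a / of_int b" "\<not> int p dvd b"
    using assms(2) by (rule padic_idealE)
  obtain c d where y: "y = of_nat p ^ l * of_int c / of_int d" "\<not> int p dvd d"
    using assms(3) by (rule padic_idealE)
  have eq: "x * y = of_nat p ^ (k + l) * of_int (a * c) / of_int (b * d)"
    unfolding x y by (simp add: power_add)
  have "\<not> int p dvd b * d"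
    using x y assms(1) by (simp add: prime_dvd_mult_iff)
  then show ?thesis unfolding eq by (rule padic_idealI)
qed

lemma padic_ideal_add:
  assumes "prime p" "x \<in> padic_ideal p k" "y \<in> padic_ideal p k"
  shows "x + y \<in> padic_ideal p k"
proof -
  obtain a b where x: "x = of_nat p ^ k * of_int a / of_int b" "\<not> int p dvd b" "b \<noteq> 0"
    using assms(2) by (rule padic_idealE)
  obtain c d where y: "y = of_nat p ^ k * of_int c / of_int d" "\<not> int p dvd d" "d \<noteq> 0"
    using assms(3) by (rule padic_idealE)
  have eq: "x + y = of_nat p ^ k * of_int (a * d + c * b) / of_int (b * d)"
    unfolding x(1) y(1) using x(3) y(3) by (simp add: add_frac_eq distrib_left mult_ac)
  have "\<not> int p dvd b * d"
    using x y assms(1) by (simp add: prime_dvd_mult_iff)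
  then show ?thesis unfolding eq by (rule padic_idealI)
qed

lemma padic_ideal_of_int: "prime p \<Longrightarrow> of_int a \<in> padic_ideal p 0"
  using padic_idealI[of p 1 0 a] by (simp add: prime_nat_iff)

lemma padic_ideal_of_nat: "prime p \<Longrightarrow> of_nat a \<in> padic_ideal p 0"
  using padic_ideal_of_int[of p "int a"] by simp

lemma padic_ideal_prime_power: "prime p \<Longrightarrow> of_nat p ^ k \<in> padic_ideal p k"
  using padic_idealI[of p 1 k 1] by (simp add: prime_nat_iff)

lemma padic_ideal_inverse:
  assumes "\<not> p dvd n" shows "1 / of_nat n \<in> padic_ideal p 0"
proof -
  have "0 < n" using assms by (auto intro: Nat.gr0I)
  then show ?thesis using padic_idealI[of p "int n" 0 1] assms by simp
qed

text \<open>The case of an integral factor, with level \<open>k\<close> instead of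
  \<open>0 + k\<close>, so that it can be applied backwards as an introduction rule.\<close>

lemma padic_ideal_scale:
  assumes "prime p" "c \<in> padic_ideal p 0" "x \<in> padic_ideal p k"
  shows "c * x \<in> padic_ideal p k"
  using padic_ideal_mult[OF assms] by simp

lemma padic_ideal_uminus:
  assumes "prime p" "x \<in> padic_ideal p k" shows "- x \<in> padic_ideal p k"
  using padic_ideal_scale[OF assms(1) padic_ideal_of_int[OF assms(1), of "-1"] assms(2)] by simp

lemma padic_ideal_diff:
  assumes "prime p" "x \<in> padic_ideal p k" "y \<in> padic_ideal p k"
  shows "x - y \<in> padic_ideal p k"
  using padic_ideal_add[OF assms(1,2) padic_ideal_uminus[OF assms(1,3)]] by simp

lemma padic_ideal_antimono:
  assumes "prime p" "x \<in> padic_ideal p l" "k \<le> l" shows "x \<in> padic_ideal p k"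
proof -
  obtain a b where x: "x = of_nat p ^ l * of_int a / of_int b" "\<not> int p dvd b"
    using assms(2) by (rule padic_idealE)
  have eq: "x = of_nat p ^ k * of_int (int p ^ (l - k) * a) / of_int b"
    using assms(3) by (simp add: x(1) flip: power_add)
  show ?thesis unfolding eq using x(2) by (rule padic_idealI)
qed

lemma padic_ideal_sum:
  assumes "prime p" "\<And>i. i \<in> A \<Longrightarrow> f i \<in> padic_ideal p k"
  shows "sum f A \<in> padic_ideal p k"
  using assms(2)
proof (induction A rule: infinite_finite_induct)
  case (insert x F)
  then show ?case by (simp add: padic_ideal_add[OF assms(1)])
qed (use padic_idealI[of p 1 k 0] assms(1) in \<open>auto simp: prime_nat_iff\<close>)

lemma padic_ideal_cancel:
  assumes "prime p" "\<not> p dvd n" "of_nat n * x \<in> padic_ideal p k"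
  shows "x \<in> padic_ideal p k"
proof -
  have "n \<noteq> 0" using assms(2) by (metis dvd_0_right)
  then show ?thesis
    using padic_ideal_scale[OF assms(1) padic_ideal_inverse[OF assms(2)] assms(3)] by simp
qed

text \<open>The valuation is read off the reduced fraction \<open>c / d\<close>, membership off some
  fraction with denominator \<open>b\<close>. Cross-multiplication links the two, and
  \<open>b\<close> contributes multiplicity zero.\<close>

lemma padic_ideal_imp_rat_cong:
  assumes "prime p" "x - y \<in> padic_ideal p k"
  shows "rat_cong p k x y"
proof (cases "x = y")
  case False
  define z where "z = x - y"
  obtain a b where ab: "z = of_nat p ^ k * of_int a / of_int b" "\<not> int p dvd b" "b \<noteq> 0"
    using assms(2) unfolding z_def by (rule padic_idealE)
  obtain c d where cd: "quotient_of z = (c, d)" by fastforce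
  then have z: "z = of_int c / of_int d" and d: "d > 0"
    by (auto simp: quotient_of_div quotient_of_denom_pos)
  have nz: "z \<noteq> 0" using False by (simp add: z_def)
  then have c: "c \<noteq> 0" and a: "a \<noteq> 0" using z ab by auto
  have p: "prime (int p)" using assms(1) by simp
  have "(of_int (c * b) :: rat) = of_int (int p ^ k * a * d)"
    using z ab d by (simp add: field_simps)
  then have eq: "c * b = int p ^ k * a * d" by (simp only: of_int_eq_iff)
  have "multiplicity (int p) c = multiplicity (int p) (c * b)"
    using p c ab by (simp add: prime_elem_multiplicity_mult_distrib not_dvd_imp_multiplicity_0)
  also have "\<dots> = k + multiplicity (int p) a + multiplicity (int p) d"
    unfolding eq using p a d
    by (simp add: prime_elem_multiplicity_mult_distrib prime_gt_0_nat[OF assms(1)]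
        multiplicity_same_power)
  finally show ?thesis
    using cd by (simp add: rat_cong_def padic_val_def z_def)
qed (simp add: rat_cong_def)

lemma padic_ideal_of_numerator_dvd:
  assumes "prime p" "int p dvd fst (quotient_of x)"
  shows "x \<in> padic_ideal p 1"
proof -
  obtain c d where cd: "quotient_of x = (c, d)" by fastforce
  then have x: "x = of_int c / of_int d" by (rule quotient_of_div)
  have "coprime c d" using cd by (rule quotient_of_coprime)
  moreover obtain e where e: "c = int p * e" using assms(2) cd by auto
  ultimately have "\<not> int p dvd d"
    using assms(1) by (meson coprime_common_divisor dvd_triv_left not_prime_unit prime_nat_int_transfer)
  then show ?thesis using padic_idealI[of p d 1 e] x e by simp
qed

section \<open>Bernoulli numbers and Faulhaber's formula\<close>

text \<open>The geometric sum of the series \<open>exp (i t)\<close> over \<open>i < j\<close>,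
  multiplied by \<open>exp t - 1\<close>, telescopes to \<open>exp (j t) - 1\<close>. Cancelling
  \<open>exp t - 1\<close> against the Bernoulli generating function and comparing coefficients at
  \<open>m + 1\<close> gives the formula.\<close>

lemma sum_powers_bernoulli:
  "(\<Sum>i<j. of_nat i ^ m) / fact m =
     (\<Sum>k\<le>m. bernoulli k / fact k * (of_nat j ^ (m + 1 - k) / fact (m + 1 - k)))"
proof -
  let ?E = "fps_exp 1 - 1 :: rat fps" and ?B = "Abs_fps (\<lambda>m. bernoulli m / fact m)"
  have "?E $ 1 = 1" by simp
  then have E: "?E \<noteq> 0" by (metis fps_zero_nth zero_neq_one)
  have "fps_exp (of_nat j) - 1 = (\<Sum>i<j. fps_exp (of_nat i)) * ?E"
  proof (induction j)
    case (Suc j)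
    have "fps_exp (of_nat (Suc j)) - 1 = fps_exp (of_nat j) - 1 + fps_exp (of_nat j) * ?E"
      by (simp add: fps_exp_add_mult algebra_simps)
    then show ?case by (simp only: Suc.IH sum.lessThan_Suc distrib_right)
  qed simp
  then have "(\<Sum>i<j. fps_exp (of_nat i)) * fps_X * ?E = ?B * (fps_exp (of_nat j) - 1) * ?E"
    using bernoulli_generating_function by (simp add: mult_ac)
  then have "(\<Sum>i<j. fps_exp (of_nat i)) * fps_X = ?B * (fps_exp (of_nat j) - 1)"
    using E by simp
  then have "((\<Sum>i<j. fps_exp (of_nat i)) * fps_X) $ (m + 1)
      = (?B * (fps_exp (of_nat j) - 1)) $ (m + 1)" by (simp only:)
  moreover have "((\<Sum>i<j. fps_exp (of_nat i)) * fps_X) $ (m + 1)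
      = (\<Sum>i<j. of_nat i ^ m) / (fact m :: rat)"
    by (simp add: fps_sum_nth sum_divide_distrib)
  \<comment> \<open>The convolution also has an index \<open>k = m + 1\<close>; its term vanishes
    because \<open>fps_exp (of_nat j) - 1\<close> has constant coefficient zero.\<close>
  moreover have "(?B * (fps_exp (of_nat j) - 1)) $ (m + 1) =
     (\<Sum>k\<le>m. bernoulli k / fact k * (of_nat j ^ (m + 1 - k) / fact (m + 1 - k)))"
    unfolding fps_mult_nth by (simp add: atMost_atLeast0 mult_ac)
  ultimately show ?thesis by (simp only:)
qed

lemma padic_ideal_inverse_fact:
  assumes "prime p" "n < p" shows "1 / fact n \<in> padic_ideal p 0"
  using padic_ideal_inverse[of p "fact n"] assms prime_dvd_fact_iff[of p n] by simp

text \<open>The power sum formula at \<open>j = 1\<close> is a recursion for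
  \<open>bernoulli n\<close> whose denominators are factorials of numbers at most
  \<open>n + 1\<close>, hence prime to \<open>p\<close>.\<close>

lemma bernoulli_padic_integral:
  assumes p: "prime p" and "n + 1 < p"
  shows "bernoulli n \<in> padic_ideal p 0"
  using assms(2)
proof (induction n rule: less_induct)
  case (less n)
  define t where "t k = bernoulli k * (1 / fact k) * (1 / fact (n + 1 - k))" for k
  \<comment> \<open>The only summand on the left is \<open>0 ^ n\<close>, which is 1 for
    \<open>n = 0\<close>.\<close>
  have "of_int (0 ^ n) * (1 / fact n) = (\<Sum>k\<le>n. t k)"
    using sum_powers_bernoulli[where j = 1 and m = n] by (simp add: t_def)
  also have "\<dots> = (\<Sum>k<n. t k) + bernoulli n / fact n"
    by (simp add: t_def flip: lessThan_Suc_atMost)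
  finally have "bernoulli n / fact n = of_int (0 ^ n) * (1 / fact n) - (\<Sum>k<n. t k)"
    by (simp only: add_diff_cancel_left')
  moreover have "fact n * (bernoulli n / fact n) = bernoulli n" by simp
  ultimately have *: "bernoulli n = fact n * (of_int (0 ^ n) * (1 / fact n) - (\<Sum>k<n. t k))"
    by (simp only:)
  have "t k \<in> padic_ideal p 0" if "k < n" for k
    unfolding t_def using that less.prems
    by (intro padic_ideal_scale p less.IH padic_ideal_inverse_fact) auto
  moreover have "fact n \<in> padic_ideal p 0"
    using padic_ideal_of_nat[OF p, of "fact n"] by simp
  ultimately show ?case unfolding * using less.prems
    by (intro padic_ideal_scale padic_ideal_diff padic_ideal_sum padic_ideal_of_int
        padic_ideal_inverse_fact p) auto
qed

text \<open>This is \<open>bernoulli k * (m + 1 choose k) / (m + 1)\<close>, written with inverse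
  factorials so that integrality can be checked factor by factor.\<close>

definition faulhaber_coeff :: "nat \<Rightarrow> nat \<Rightarrow> rat" where
  "faulhaber_coeff m k = fact m * (1 / fact k * (1 / fact (m + 1 - k) * bernoulli k))"

lemma faulhaber:
  "(\<Sum>i<j. of_nat i ^ m) = (\<Sum>k\<le>m. faulhaber_coeff m k * of_nat j ^ (m + 1 - k))"
proof -
  have "(\<Sum>i<j. of_nat i ^ m) = fact m * ((\<Sum>i<j. of_nat i ^ m) / fact m :: rat)" by simp
  then show ?thesis
    unfolding sum_powers_bernoulli by (simp add: sum_distrib_left faulhaber_coeff_def mult_ac)
qed

lemma faulhaber_coeff_padic:
  assumes p: "prime p" and "m + 1 < p" "k \<le> m" "bernoulli k \<in> padic_ideal p l"
  shows "faulhaber_coeff m k \<in> padic_ideal p l"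
  unfolding faulhaber_coeff_def
  using padic_ideal_of_nat[OF p, of "fact m"] assms
  by (intro padic_ideal_scale padic_ideal_inverse_fact p) auto

text \<open>In Faulhaber's formula at \<open>j = p\<close> every term carries a positive power of
  \<open>p\<close>, and the coefficients are integral at \<open>p\<close> because
  \<open>m + 1 < p\<close>.\<close>

lemma power_sum_padic:
  assumes p: "prime p" and m: "0 < m" "m + 1 < p"
  shows "(\<Sum>j = 1..<p. of_nat j ^ m) \<in> padic_ideal p 1"
proof -
  have "faulhaber_coeff m k * of_nat p ^ (m + 1 - k) \<in> padic_ideal p 1" if "k \<le> m" for k
  proof -
    have "of_nat p ^ (m + 1 - k) \<in> padic_ideal p 1"
      using padic_ideal_antimono[OF p padic_ideal_prime_power[OF p, of "m + 1 - k"]] that by auto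
    then show ?thesis
      using that m by (intro padic_ideal_scale p faulhaber_coeff_padic bernoulli_padic_integral) auto
  qed
  then have "(\<Sum>j<p. of_nat j ^ m) \<in> padic_ideal p 1"
    unfolding faulhaber by (intro padic_ideal_sum p) auto
  moreover have "(\<Sum>j<p. of_nat j ^ m :: rat) = (\<Sum>j = 1..<p. of_nat j ^ m)"
    by (rule sum.mono_neutral_right) (use m in auto)
  ultimately show ?thesis by simp
qed

section \<open>Fermat's little theorem and the double sum modulo \<open>p\<close>\<close>

lemma fermat_padic:
  assumes p: "prime p" and "\<not> p dvd j"
  shows "of_nat j ^ (p - 1) - 1 \<in> padic_ideal p 1"
proof -
  have "[int (j ^ (p - 1)) = int 1] (mod int p)"
    using fermat_theorem[OF assms] by (simp only: cong_int_iff)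
  then obtain c where "int (j ^ (p - 1)) - int 1 = int p * c"
    unfolding cong_iff_dvd_diff by (rule dvdE)
  then have "(of_int (int (j ^ (p - 1)) - int 1) :: rat) = of_int (int p * c)" by (simp only:)
  then have "of_nat j ^ (p - 1) - 1 = (of_nat p ^ 1 * of_int c / of_int 1 :: rat)" by simp
  then show ?thesis using padic_idealI[of p 1 1 c] p by (simp add: prime_nat_iff)
qed

text \<open>Fermat's congruence multiplied by \<open>- 1 / j ^ s\<close>; it turns harmonic sums
  into power sums.\<close>

lemma inverse_power_padic:
  assumes p: "prime p" and j: "\<not> p dvd j" and s: "s \<le> p - 1"
  shows "1 / of_nat j ^ s - of_nat j ^ (p - 1 - s) \<in> padic_ideal p 1"
proof -
  have j0: "of_nat j \<noteq> (0 :: rat)" using j by (cases "j = 0") auto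
  have "\<not> p dvd j ^ s" using j p prime_dvd_power by blast
  from padic_ideal_inverse[OF this] have "1 / of_nat j ^ s \<in> padic_ideal p 0" by simp
  from padic_ideal_uminus[OF p padic_ideal_scale[OF p this fermat_padic[OF p j]]]
  have "- (1 / of_nat j ^ s * (of_nat j ^ (p - 1) - 1)) \<in> padic_ideal p 1" .
  also have "of_nat j ^ (p - 1) = (of_nat j ^ s * of_nat j ^ (p - 1 - s) :: rat)"
    by (simp only: s le_add_diff_inverse flip: power_add)
  also have "- (1 / of_nat j ^ s * (\<dots> - 1)) = 1 / of_nat j ^ s - of_nat j ^ (p - 1 - s)"
    using j0 by (simp add: field_simps)
  finally show ?thesis .
qed

text \<open>Modulo \<open>p\<close>, \<open>1 / j ^ 2\<close> becomes \<open>j ^ (p - 3)\<close> and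
  \<open>1 / i\<close> becomes \<open>i ^ (p - 2)\<close>. Faulhaber's formula for the inner sum
  then leaves power sums over \<open>j\<close> with exponents \<open>2 * p - 4 - k\<close>, where
  \<open>k \<le> p - 2\<close>.\<close>

lemma double_harmonic_padic:
  assumes p: "prime p" "3 < p" and B: "bernoulli (p - 3) \<in> padic_ideal p 1"
  shows "(\<Sum>j = 1..<p. H1 (j - 1) / of_nat j ^ 2) \<in> padic_ideal p 1"
proof -
  let ?f = "\<lambda>j. of_nat j ^ (p - 3) * (\<Sum>i<j. of_nat i ^ (p - 2)) :: rat"
  have 1: "H1 (j - 1) / of_nat j ^ 2 - ?f j \<in> padic_ideal p 1" if "j \<in> {1..<p}" for j
  proof -
    have ndvd: "\<not> p dvd i" if "0 < i" "i < p" for i using that by (auto dest: dvd_imp_le)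
    have "(\<Sum>i<j. of_nat i ^ (p - 2) :: rat) = (\<Sum>i = 1..j - 1. of_nat i ^ (p - 2))"
      by (rule sum.mono_neutral_right) (use p that in auto)
    then have "H1 (j - 1) - (\<Sum>i<j. of_nat i ^ (p - 2))
        = (\<Sum>i = 1..j - 1. 1 / of_nat i - of_nat i ^ (p - 2))"
      by (simp add: H1_def sum_subtractf)
    also have "\<dots> \<in> padic_ideal p 1"
    proof (rule padic_ideal_sum[OF p(1)])
      fix i assume "i \<in> {1..j - 1}"
      with that have "\<not> p dvd i" by (intro ndvd) auto
      from inverse_power_padic[OF p(1) this, of 1]
      show "1 / of_nat i - of_nat i ^ (p - 2) \<in> padic_ideal p 1"
        using p by (simp add: numeral_2_eq_2)
    qed
    finally have a: "H1 (j - 1) - (\<Sum>i<j. of_nat i ^ (p - 2)) \<in> padic_ideal p 1" .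
    have "1 / of_nat j ^ 2 - of_nat j ^ (p - 3) \<in> padic_ideal p 1"
    proof -
      have "\<not> p dvd j" "2 \<le> p - 1" using that p by (auto intro!: ndvd)
      from inverse_power_padic[OF p(1) this] show ?thesis by (simp add: numeral_3_eq_3)
    qed
    moreover have "1 / of_nat j ^ 2 \<in> padic_ideal p 0"
      using padic_ideal_inverse[of p "j ^ 2"] ndvd[of j] that p by (auto simp: prime_dvd_power_iff)
    moreover have "(\<Sum>i<j. of_nat i ^ (p - 2)) \<in> padic_ideal p 0"
      using padic_ideal_of_nat[OF p(1), of "\<Sum>i<j. i ^ (p - 2)"] by simp
    \<comment> \<open>The difference of two products is split as
      \<open>a * b - a' * b' = a * (b - b') + b' * (a - a')\<close>.\<close>
    ultimately have "1 / of_nat j ^ 2 * (H1 (j - 1) - (\<Sum>i<j. of_nat i ^ (p - 2))) +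
        (\<Sum>i<j. of_nat i ^ (p - 2)) * (1 / of_nat j ^ 2 - of_nat j ^ (p - 3)) \<in> padic_ideal p 1"
      using a p by (intro padic_ideal_add padic_ideal_scale)
    then show ?thesis by (simp add: algebra_simps)
  qed
  have "(\<Sum>j = 1..<p. ?f j) = (\<Sum>j = 1..<p. \<Sum>k\<le>p - 2.
      faulhaber_coeff (p - 2) k * of_nat j ^ (p - 3 + (p - 2 + 1 - k)))"
    unfolding faulhaber by (simp add: sum_distrib_left power_add mult_ac)
  also have "\<dots> = (\<Sum>k\<le>p - 2. faulhaber_coeff (p - 2) k *
      (\<Sum>j = 1..<p. of_nat j ^ (p - 3 + (p - 2 + 1 - k))))"
    by (subst sum.swap) (simp add: sum_distrib_left)
  also have "\<dots> \<in> padic_ideal p 1"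
  proof (rule padic_ideal_sum[OF p(1)])
    fix k assume k: "k \<in> {..p - 2}"
    let ?e = "p - 3 + (p - 2 + 1 - k)"
    let ?S = "\<Sum>j = 1..<p. of_nat j ^ ?e :: rat"
    have c0: "faulhaber_coeff (p - 2) k \<in> padic_ideal p 0"
      using k p by (intro faulhaber_coeff_padic bernoulli_padic_integral) auto
    consider "k = p - 3" | "k = p - 2" | "k < p - 3" using k by force
    then show "faulhaber_coeff (p - 2) k * ?S \<in> padic_ideal p 1"
    proof cases
      case 1
      \<comment> \<open>Here the exponent is \<open>p - 1\<close>, so the power sum is -1 modulo
        \<open>p\<close>; the factor \<open>p\<close> has to come from \<open>B\<close>.\<close>
      have "faulhaber_coeff (p - 2) k \<in> padic_ideal p 1"
        using 1 p B by (intro faulhaber_coeff_padic) auto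
      moreover have "?S \<in> padic_ideal p 0"
        using padic_ideal_of_nat[OF p(1), of "\<Sum>j = 1..<p. j ^ ?e"] by simp
      ultimately show ?thesis
        by (subst mult.commute) (rule padic_ideal_scale[OF p(1)])
    next
      case 2
      then have e: "?e = p - 2" using p by simp
      have "?S \<in> padic_ideal p 1" unfolding e using p by (intro power_sum_padic) auto
      with c0 show ?thesis by (intro padic_ideal_scale p)
    next
      case 3
      \<comment> \<open>Fermat removes \<open>p - 1\<close> from the exponent; the remaining
        \<open>p - 3 - k\<close> is positive and small enough for
        \<open>power_sum_padic\<close>.\<close>
      then have e: "?e = (p - 1) + (p - 3 - k)" using p by simp
      have "of_nat j ^ ?e - of_nat j ^ (p - 3 - k) \<in> padic_ideal p 1" if "j \<in> {1..<p}" for j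
      proof -
        have "\<not> p dvd j" using that by (auto dest: dvd_imp_le)
        from padic_ideal_scale[OF p(1) _ fermat_padic[OF p(1) this], of "of_nat j ^ (p - 3 - k)"]
        show ?thesis using padic_ideal_of_nat[OF p(1), of "j ^ (p - 3 - k)"]
          unfolding e power_add by (simp add: algebra_simps)
      qed
      then have "(\<Sum>j = 1..<p. of_nat j ^ ?e - of_nat j ^ (p - 3 - k)) \<in> padic_ideal p 1"
        by (rule padic_ideal_sum[OF p(1)])
      from padic_ideal_add[OF p(1) this power_sum_padic[of p "p - 3 - k"]]
      have "?S \<in> padic_ideal p 1" using p 3 by (simp add: sum_subtractf)
      with c0 show ?thesis by (intro padic_ideal_scale p)
    qed
  qed
  finally have "(\<Sum>j = 1..<p. ?f j) \<in> padic_ideal p 1" .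
  moreover have "(\<Sum>j = 1..<p. H1 (j - 1) / of_nat j ^ 2 - ?f j) \<in> padic_ideal p 1"
    by (rule padic_ideal_sum[OF p(1) 1])
  ultimately have "(\<Sum>j = 1..<p. ?f j) + (\<Sum>j = 1..<p. H1 (j - 1) / of_nat j ^ 2 - ?f j)
      \<in> padic_ideal p 1" by (rule padic_ideal_add[OF p(1)])
  then show ?thesis by (simp only: sum_subtractf add_diff_cancel_left' add_diff_eq)
qed

section \<open>Pairing \<open>i\<close> with \<open>p - i\<close>\<close>

text \<open>Meant for \<open>x = i\<close> and \<open>y = p - i\<close>, so that
  \<open>x + y = p\<close> factors out. The cofactor is written in \<open>x + y\<close> and
  \<open>x\<close>, which makes it an integer polynomial in \<open>p\<close> and
  \<open>i\<close>.\<close>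

lemma sum_inverse_cubes:
  fixes x y :: "'a :: field"
  assumes "x \<noteq> 0" "y \<noteq> 0"
  shows "1 / x ^ 3 + 1 / y ^ 3
    = ((x + y)\<^sup>2 - 3 * (x + y) * x + 3 * x\<^sup>2) * (1 / (x ^ 3 * y ^ 3)) * (x + y)"
proof -
  have "1 / x ^ 3 + 1 / y ^ 3 = (x ^ 3 + y ^ 3) * (1 / (x ^ 3 * y ^ 3))"
    using assms by (simp add: add_frac_eq add.commute)
  also have "x ^ 3 + y ^ 3 = ((x + y)\<^sup>2 - 3 * (x + y) * x + 3 * x\<^sup>2) * (x + y)"
    by (simp add: algebra_simps power2_eq_square power3_eq_cube)
  finally show ?thesis by (simp only: mult_ac)
qed

text \<open>The geometric expansion of \<open>1 / y = 1 / (s - x)\<close> in powers of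
  \<open>s = x + y\<close>, stopped after \<open>s\<^sup>2\<close> with its exact remainder; again
  \<open>s\<close> will be \<open>p\<close>.\<close>

lemma sum_inverses:
  fixes x y :: "'a :: field"
  assumes "x \<noteq> 0" "y \<noteq> 0"
  shows "1 / x + 1 / y
    = 1 / (x ^ 3 * y) * (x + y) ^ 3 - (x + y)\<^sup>2 * (1 / x ^ 3) - (x + y) * (1 / x\<^sup>2)"
proof -
  have "x ^ 3 * y \<noteq> 0" using assms by simp
  moreover have "(x ^ 3 * y) * (1 / x + 1 / y) = x\<^sup>2 * (x + y)"
    using assms by (simp add: distrib_left power2_eq_square power3_eq_cube)
  moreover have "(x ^ 3 * y) *
        (1 / (x ^ 3 * y) * (x + y) ^ 3 - (x + y)\<^sup>2 * (1 / x ^ 3) - (x + y) * (1 / x\<^sup>2))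
      = (x + y) ^ 3 - y * (x + y)\<^sup>2 - x * y * (x + y)"
    using assms by (simp add: right_diff_distrib power2_eq_square power3_eq_cube)
  moreover have "x\<^sup>2 * (x + y) = (x + y) ^ 3 - y * (x + y)\<^sup>2 - x * y * (x + y)"
    by (simp add: algebra_simps power2_eq_square power3_eq_cube)
  ultimately show ?thesis by (metis mult_left_cancel)
qed

text \<open>Summing \<open>sum_inverses\<close> over all pairs leaves, besides the
  \<open>p\<^sup>3\<close> term, \<open>p\<^sup>2\<close> times the sum of inverse cubes. The same
  pairing shows that this sum is divisible by \<open>p\<close>.\<close>

lemma harmonic_reflection_padic:
  assumes p: "prime p" "2 < p"
  shows "2 * H1 (p - 1) + of_nat p * (\<Sum>i = 1..<p. 1 / of_nat i ^ 2) \<in> padic_ideal p 3"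
proof -
  have reflect: "(\<Sum>i = 1..<p. f (p - i)) = (\<Sum>i = 1..<p. f i)" for f :: "nat \<Rightarrow> rat"
    by (rule sum.reindex_bij_witness[of _ "\<lambda>i. p - i" "\<lambda>i. p - i"]) auto
  have ndvd: "\<not> p dvd i" "\<not> p dvd p - i" if "i \<in> {1..<p}" for i
    using that by (auto dest: dvd_imp_le)
  let ?q = "of_nat p :: rat"
  define c where "c i = 1 / (of_nat i ^ 3 * of_nat (p - i) ^ 3 :: rat)" for i
  define d where "d i = 1 / (of_nat i ^ 3 * of_nat (p - i) :: rat)" for i
  have c: "c i \<in> padic_ideal p 0" if "i \<in> {1..<p}" for i
    using padic_ideal_inverse[of p "i ^ 3 * (p - i) ^ 3"] ndvd[OF that] p
    by (simp add: c_def prime_dvd_mult_iff prime_dvd_power_iff)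
  have d: "d i \<in> padic_ideal p 0" if "i \<in> {1..<p}" for i
    using padic_ideal_inverse[of p "i ^ 3 * (p - i)"] ndvd[OF that] p
    by (simp add: d_def prime_dvd_mult_iff prime_dvd_power_iff)
  have cubes: "(\<Sum>i = 1..<p. 1 / of_nat i ^ 3) \<in> padic_ideal p 1"
  proof -
    have "of_nat 2 * (\<Sum>i = 1..<p. 1 / of_nat i ^ 3 :: rat)
        = (\<Sum>i = 1..<p. 1 / of_nat i ^ 3 + 1 / of_nat (p - i) ^ 3)"
      unfolding sum.distrib reflect[of "\<lambda>i. 1 / of_nat i ^ 3"] by simp
    also have "\<dots> = (\<Sum>i = 1..<p. of_int ((int p)\<^sup>2 - 3 * int p * int i + 3 * (int i)\<^sup>2) * c i * ?q ^ 1)"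
    proof (rule sum.cong[OF refl])
      fix i assume "i \<in> {1..<p}"
      then have nz: "of_nat i \<noteq> (0 :: rat)" "of_nat (p - i) \<noteq> (0 :: rat)"
        and q: "?q = of_nat i + of_nat (p - i)"
        by (auto simp flip: of_nat_add)
      show "1 / of_nat i ^ 3 + 1 / of_nat (p - i) ^ 3
          = of_int ((int p)\<^sup>2 - 3 * int p * int i + 3 * (int i)\<^sup>2) * c i * ?q ^ 1"
        unfolding c_def sum_inverse_cubes[OF nz] q[symmetric] by simp
    qed
    also have "\<dots> \<in> padic_ideal p 1"
      by (intro padic_ideal_sum padic_ideal_scale padic_ideal_of_int padic_ideal_prime_power p c)
    \<comment> \<open>Pairing produced twice the sum; 2 is invertible because \<open>p\<close> is
      odd.\<close>
    finally show ?thesis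
      by (rule padic_ideal_cancel[OF p(1), rotated]) (use p in \<open>auto dest: dvd_imp_le\<close>)
  qed
  have H: "H1 (p - 1) = (\<Sum>i = 1..<p. 1 / of_nat i)"
    unfolding H1_def by (rule sum.cong) (use p in auto)
  have "2 * H1 (p - 1) = (\<Sum>i = 1..<p. 1 / of_nat i + 1 / of_nat (p - i))"
    unfolding sum.distrib reflect[of "\<lambda>i. 1 / of_nat i"] H by simp
  also have "\<dots> = (\<Sum>i = 1..<p. d i * ?q ^ 3 - ?q\<^sup>2 * (1 / of_nat i ^ 3) - ?q * (1 / of_nat i ^ 2))"
  proof (rule sum.cong[OF refl])
    fix i assume "i \<in> {1..<p}"
    then have nz: "of_nat i \<noteq> (0 :: rat)" "of_nat (p - i) \<noteq> (0 :: rat)"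
      and q: "?q = of_nat i + of_nat (p - i)"
      by (auto simp flip: of_nat_add)
    show "1 / of_nat i + 1 / of_nat (p - i)
        = d i * ?q ^ 3 - ?q\<^sup>2 * (1 / of_nat i ^ 3) - ?q * (1 / of_nat i ^ 2)"
      unfolding d_def sum_inverses[OF nz] q[symmetric] by simp
  qed
  also have "\<dots> = (\<Sum>i = 1..<p. d i * ?q ^ 3) - ?q\<^sup>2 * (\<Sum>i = 1..<p. 1 / of_nat i ^ 3)
      - ?q * (\<Sum>i = 1..<p. 1 / of_nat i ^ 2)"
    by (simp only: sum_subtractf sum_distrib_left)
  finally have "2 * H1 (p - 1) + ?q * (\<Sum>i = 1..<p. 1 / of_nat i ^ 2)
      = (\<Sum>i = 1..<p. d i * ?q ^ 3) - ?q\<^sup>2 * (\<Sum>i = 1..<p. 1 / of_nat i ^ 3)" by simp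
  also have "\<dots> \<in> padic_ideal p 3"
  proof (rule padic_ideal_diff[OF p(1)])
    show "(\<Sum>i = 1..<p. d i * ?q ^ 3) \<in> padic_ideal p 3"
      by (intro padic_ideal_sum padic_ideal_scale padic_ideal_prime_power p d)
    show "?q\<^sup>2 * (\<Sum>i = 1..<p. 1 / of_nat i ^ 3) \<in> padic_ideal p 3"
      using padic_ideal_mult[OF p(1) padic_ideal_prime_power[OF p(1), of 2] cubes] by simp
  qed
  finally show ?thesis .
qed

section \<open>Harmonic numbers through binomial coefficients\<close>

lemma H1_Suc: "H1 (Suc n) = H1 n + 1 / of_nat (Suc n)"
  by (simp add: H1_def)

text \<open>By Pascal's rule and absorption, passing from \<open>n\<close> to \<open>Suc n\<close>
  adds \<open>1 / Suc n\<close> times an alternating sum of binomial coefficients over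
  \<open>j \<ge> 1\<close>, which equals 1.\<close>

lemma H1_eq_alternating_sum:
  "H1 n = (\<Sum>j = 1..n. (-1) ^ (j - 1) * of_nat (n choose j) / of_nat j)"
proof (induction n)
  case (Suc n)
  have pascal: "of_nat (Suc n choose j) / of_nat j
      = of_nat (n choose j) / of_nat j + of_nat (Suc n choose j) / (of_nat (Suc n) :: rat)"
    if j: "j \<in> {1..Suc n}" for j
  proof -
    obtain i where i: "j = Suc i" using j by (cases j) auto
    let ?A = "of_nat (Suc n choose Suc i) :: rat"
    have "Suc n * (n choose i) = (Suc n choose Suc i) * Suc i" by (rule Suc_times_binomial_eq)
    then have "of_nat (Suc n) * of_nat (n choose i) = ?A * of_nat (Suc i)" by (metis of_nat_mult)
    then have "?A / of_nat (Suc n) = of_nat (n choose i) / of_nat (Suc i)"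
      by (simp add: frac_eq_eq mult.commute del: of_nat_Suc binomial_Suc_Suc)
    moreover have "?A = of_nat (n choose i) + of_nat (n choose Suc i)" by simp
    ultimately show ?thesis unfolding i by (simp only: add_divide_distrib add.commute)
  qed
  have "(\<Sum>j\<le>Suc n. (-1) ^ j * of_nat (Suc n choose j)) = (0 :: rat)"
    by (rule choose_alternating_sum) simp
  then have "(\<Sum>i\<le>n. (-1) ^ i * of_nat (Suc n choose Suc i)) = (1 :: rat)"
    by (subst (asm) sum.atMost_Suc_shift) (simp add: sum_negf del: binomial_Suc_Suc)
  then have one: "(\<Sum>j = 1..Suc n. (-1) ^ (j - 1) * of_nat (Suc n choose j)) = (1 :: rat)"
    by (simp add: sum.shift_bounds_cl_Suc_ivl atMost_atLeast0 del: sum.cl_ivl_Suc binomial_Suc_Suc)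
  have "(\<Sum>j = 1..Suc n. (-1) ^ (j - 1) * of_nat (Suc n choose j) / of_nat j :: rat)
      = (\<Sum>j = 1..Suc n. (-1) ^ (j - 1) * (of_nat (n choose j) / of_nat j)
          + (-1) ^ (j - 1) * of_nat (Suc n choose j) * (1 / of_nat (Suc n)))"
    by (rule sum.cong[OF refl], subst times_divide_eq_right[symmetric], subst pascal)
      (simp_all add: algebra_simps)
  \<comment> \<open>The extra index \<open>j = Suc n\<close> in the first sum contributes nothing,
    as \<open>n choose Suc n\<close> is zero.\<close>
  also have "\<dots> = H1 n + 1 / of_nat (Suc n)"
    unfolding sum.distrib sum_distrib_right[symmetric] one by (simp add: Suc.IH)
  finally show ?case by (simp only: H1_Suc)
qed (simp add: H1_def)

text \<open>The signed binomial coefficient is the product of \<open>1 - p / i\<close> over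
  \<open>1 \<le> i \<le> j\<close>, which is expanded to first order in \<open>p\<close>.\<close>

lemma binomial_prime_pred_padic:
  assumes p: "prime p" and "j < p"
  shows "(-1) ^ j * of_nat ((p - 1) choose j) - (1 - of_nat p * H1 j) \<in> padic_ideal p 2"
  using assms(2)
proof (induction j)
  case 0
  then show ?case using padic_ideal_scale[OF p padic_ideal_of_nat[OF p, of 0] padic_ideal_prime_power[OF p]]
    by (simp add: H1_def)
next
  case (Suc j)
  let ?q = "of_nat p :: rat" and ?s = "of_nat (Suc j) :: rat"
  let ?c = "\<lambda>j. (-1) ^ j * of_nat ((p - 1) choose j) :: rat"
  have inv: "1 / ?s \<in> padic_ideal p 0"
    using Suc.prems by (intro padic_ideal_inverse) (auto dest: dvd_imp_le)
  have H: "H1 j \<in> padic_ideal p 0"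
    unfolding H1_def using Suc.prems
    by (intro padic_ideal_sum p padic_ideal_inverse) (auto dest: dvd_imp_le)
  have "Suc j * ((p - 1) choose Suc j) = (p - 1 - j) * ((p - 1) choose j)"
    by (metis binomial_absorb_comp binomial_absorption)
  then have "?s * of_nat ((p - 1) choose Suc j) = (of_nat (p - 1 - j) :: rat) * of_nat ((p - 1) choose j)"
    by (metis of_nat_mult)
  moreover have "of_nat (p - 1 - j) = ?q - ?s" using Suc.prems by (simp add: of_nat_diff)
  ultimately have choose: "of_nat ((p - 1) choose Suc j) = (1 / ?s * ?q - 1) * of_nat ((p - 1) choose j)"
    by (simp add: field_simps del: of_nat_Suc)
  have rec: "?c (Suc j) = (1 - 1 / ?s * ?q) * ?c j"
    unfolding choose by (simp add: algebra_simps del: of_nat_Suc)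
  \<comment> \<open>The new error is the old one times the new factor, plus the second-order term of
    \<open>(1 - p / Suc j) * (1 - p * H1 j)\<close>.\<close>
  have "?c (Suc j) - (1 - ?q * H1 (Suc j))
      = (1 - 1 / ?s * ?q) * (?c j - (1 - ?q * H1 j)) + 1 / ?s * (H1 j * ?q ^ 2)"
    unfolding rec H1_Suc by (simp add: algebra_simps power2_eq_square del: of_nat_Suc)
  also have "\<dots> \<in> padic_ideal p 2"
  proof (intro padic_ideal_add padic_ideal_scale p inv H padic_ideal_prime_power)
    show "1 - 1 / ?s * ?q \<in> padic_ideal p 0"
      using padic_ideal_diff[OF p padic_ideal_of_nat[OF p, of 1]
          padic_ideal_scale[OF p inv padic_ideal_of_nat[OF p, of p]]] by simp
    show "?c j - (1 - ?q * H1 j) \<in> padic_ideal p 2"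
      using Suc by simp
  qed
  finally show ?case .
qed

text \<open>Absorption turns \<open>(p choose j) / j\<close> into \<open>p / j ^ 2\<close> times
  \<open>(p - 1) choose (j - 1)\<close>. The factor \<open>p\<close> raises the precision of
  \<open>binomial_prime_pred_padic\<close> from \<open>p\<^sup>2\<close> to
  \<open>p\<^sup>3\<close>.\<close>

lemma harmonic_binomial_padic:
  assumes p: "prime p" "2 < p"
  shows "H1 (p - 1) - of_nat p * (\<Sum>j = 1..<p. 1 / of_nat j ^ 2)
      + of_nat p ^ 2 * (\<Sum>j = 1..<p. H1 (j - 1) / of_nat j ^ 2) \<in> padic_ideal p 3"
proof -
  let ?q = "of_nat p :: rat"
  let ?c = "\<lambda>j. (-1) ^ j * of_nat ((p - 1) choose j) :: rat"
  have absorb: "(-1) ^ (j - 1) * of_nat (p choose j) / of_nat j = ?q * (?c (j - 1) / of_nat j ^ 2)"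
    if j: "j \<in> {1..<p}" for j
  proof -
    obtain i where i: "j = Suc i" using j by (cases j) auto
    have "Suc i * (p choose Suc i) = p * ((p - 1) choose i)"
      using p by (intro binomial_absorption)
    then have "of_nat (Suc i) * of_nat (p choose Suc i) = (?q * of_nat ((p - 1) choose i) :: rat)"
      by (metis of_nat_mult)
    then show ?thesis unfolding i by (simp add: field_simps power2_eq_square del: of_nat_Suc)
  qed
  \<comment> \<open>Evenness gives the term \<open>j = p\<close> of the alternating sum the sign
    plus, so it cancels the last term \<open>1 / p\<close> of \<open>H1 p\<close>.\<close>
  have even: "even (p - 1)" using prime_odd_nat[OF p] p by auto
  obtain m where m: "p = Suc m" using p by (cases p) auto
  have "H1 (p - 1) + 1 / ?q = H1 p" unfolding m by (simp add: H1_Suc)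
  also have "\<dots> = (\<Sum>j = 1..<p. (-1) ^ (j - 1) * of_nat (p choose j) / of_nat j) + 1 / ?q"
    unfolding H1_eq_alternating_sum[of p] using p even
    by (simp add: m atLeastLessThanSuc_atLeastAtMost)
  finally have "H1 (p - 1) = (\<Sum>j = 1..<p. (-1) ^ (j - 1) * of_nat (p choose j) / of_nat j)"
    by (simp only: add_right_cancel)
  also have "\<dots> = (\<Sum>j = 1..<p. ?q * (?c (j - 1) / of_nat j ^ 2))"
    by (rule sum.cong[OF refl absorb])
  finally have H: "H1 (p - 1) = (\<Sum>j = 1..<p. ?q * (?c (j - 1) / of_nat j ^ 2))" .
  have "H1 (p - 1) - ?q * (\<Sum>j = 1..<p. 1 / of_nat j ^ 2)
      + ?q ^ 2 * (\<Sum>j = 1..<p. H1 (j - 1) / of_nat j ^ 2)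
      = (\<Sum>j = 1..<p. 1 / of_nat j ^ 2 * (?q ^ 1 * (?c (j - 1) - (1 - ?q * H1 (j - 1)))))"
    unfolding H sum_distrib_left sum_subtractf[symmetric] sum.distrib[symmetric]
    by (auto intro!: sum.cong simp: diff_divide_distrib algebra_simps power2_eq_square)
  also have "\<dots> \<in> padic_ideal p 3"
  proof (rule padic_ideal_sum[OF p(1)])
    fix j assume j: "j \<in> {1..<p}"
    then have "\<not> p dvd j" by (auto dest: dvd_imp_le)
    then have inv: "1 / of_nat j ^ 2 \<in> padic_ideal p 0"
      using padic_ideal_inverse[of p "j ^ 2"] p by (simp add: prime_dvd_power_iff)
    have "j - 1 < p" using j by auto
    from padic_ideal_mult[OF p(1) padic_ideal_prime_power[OF p(1), of 1]
        binomial_prime_pred_padic[OF p(1) this]]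
    have "?q ^ 1 * (?c (j - 1) - (1 - ?q * H1 (j - 1))) \<in> padic_ideal p 3"
      by (simp add: numeral_3_eq_3)
    from padic_ideal_scale[OF p(1) inv this]
    show "1 / of_nat j ^ 2 * (?q ^ 1 * (?c (j - 1) - (1 - ?q * H1 (j - 1)))) \<in> padic_ideal p 3" .
  qed
  finally show ?thesis .
qed

section \<open>From Bernoulli numerators to the uniqueness assumption\<close>

text \<open>The two relations contain \<open>p * S\<close> with opposite signs, so adding them
  isolates \<open>3 * H1 (p - 1)\<close>; 3 is invertible since \<open>3 < p\<close>.\<close>

lemma harmonic_padic_if_bernoulli:
  assumes p: "prime p" "3 < p" and B: "bernoulli (p - 3) \<in> padic_ideal p 1"
  shows "H1 (p - 1) \<in> padic_ideal p 3"
proof -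
  let ?q = "of_nat p :: rat"
  define S where "S = (\<Sum>i = 1..<p. 1 / of_nat i ^ 2 :: rat)"
  define D where "D = (\<Sum>j = 1..<p. H1 (j - 1) / of_nat j ^ 2)"
  have D: "?q ^ 2 * D \<in> padic_ideal p 3"
    using padic_ideal_mult[OF p(1) padic_ideal_prime_power[OF p(1), of 2]
        double_harmonic_padic[OF p B]] by (simp add: D_def)
  have "H1 (p - 1) - ?q * S + ?q ^ 2 * D \<in> padic_ideal p 3"
    using harmonic_binomial_padic[of p] p by (simp add: S_def D_def)
  from padic_ideal_diff[OF p(1) this D]
  have "H1 (p - 1) - ?q * S \<in> padic_ideal p 3" by (simp only: add_diff_cancel_right')
  moreover have "2 * H1 (p - 1) + ?q * S \<in> padic_ideal p 3"
    using harmonic_reflection_padic[of p] p by (simp add: S_def)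
  ultimately have "(H1 (p - 1) - ?q * S) + (2 * H1 (p - 1) + ?q * S) \<in> padic_ideal p 3"
    by (rule padic_ideal_add[OF p(1)])
  then have "of_nat 3 * H1 (p - 1) \<in> padic_ideal p 3" by (simp add: algebra_simps)
  then show ?thesis
    by (rule padic_ideal_cancel[OF p(1), rotated]) (use p in \<open>auto dest: dvd_imp_le\<close>)
qed

theorem proposition1p6:
  assumes uniqueness_1_1:
    "\<And>b\<^sub>0 b\<^sub>1 :: rat.
       (\<forall>\<^sub>F p :: nat in at_top. prime p \<longrightarrow>
          rat_cong p 4 (of_nat ((p - 1) choose (p - 1)))
                       (b\<^sub>0 + b\<^sub>1 * of_nat p * H1 (p - 1)))
       \<Longrightarrow> b\<^sub>0 = poly (extremal_poly 0 1) 1 \<and> b\<^sub>1 = poly (extremal_poly 1 1) 1"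
  shows "infinite {p :: nat. prime p \<and> 3 \<le> p \<and>
           \<not> int p dvd fst (quotient_of (bernoulli (p - 3)))}"
proof
  let ?A = "{p :: nat. prime p \<and> 3 \<le> p \<and> \<not> int p dvd fst (quotient_of (bernoulli (p - 3)))}"
  assume "finite ?A"
  then obtain N where N: "\<forall>p\<in>?A. p \<le> N"
    unfolding finite_nat_set_iff_bounded_le by (rule exE)
  \<comment> \<open>The binomial coefficient is 1, so the two sides differ by
    \<open>- p * H1 (p - 1)\<close>. The bound includes 3 because
    \<open>harmonic_padic_if_bernoulli\<close> requires \<open>3 < p\<close>.\<close>
  have cong: "rat_cong p 4 (of_nat ((p - 1) choose (p - 1))) (1 + 1 * of_nat p * H1 (p - 1))"
    if p: "prime p" "max 3 N < p" for p
  proof -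
    have "p \<notin> ?A" using N p by auto
    then have "int p dvd fst (quotient_of (bernoulli (p - 3)))" using p by simp
    from padic_ideal_of_numerator_dvd[OF p(1) this] have "H1 (p - 1) \<in> padic_ideal p 3"
      using p by (intro harmonic_padic_if_bernoulli) auto
    from padic_ideal_mult[OF p(1) padic_ideal_prime_power[OF p(1), of 1] this]
    have "of_nat p * H1 (p - 1) \<in> padic_ideal p 4" by simp
    from padic_ideal_uminus[OF p(1) this] show ?thesis
      by (intro padic_ideal_imp_rat_cong p) simp
  qed
  have "(1 :: rat) = poly (extremal_poly 1 1) 1"
  proof (rule uniqueness_1_1[of 1, THEN conjunct2])
    show "\<forall>\<^sub>F p in at_top. prime p \<longrightarrow>
        rat_cong p 4 (of_nat ((p - 1) choose (p - 1))) (1 + 1 * of_nat p * H1 (p - 1))"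
      using cong by (intro eventually_mono[OF eventually_gt_at_top[of "max 3 N"]]) blast
  qed
  \<comment> \<open>The pair (1, 0) satisfies the congruence with equality; its second component
    must agree with that of (1, 1).\<close>
  moreover have "(0 :: rat) = poly (extremal_poly 1 1) 1"
    by (rule uniqueness_1_1[of 1, THEN conjunct2]) (simp add: rat_cong_def)
  ultimately show False by simp
qed

end
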